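(* Let $\Omega$ be an open bounded set in a locally connected metric measure space $X$, and let $f\in C(\overline{\Omega})$ be strongly harmonic in $\Omega$. Then $\sup_{\overline{\Omega}}f=\sup_{\partial\Omega}f$.
   Context: Standing assumptions: $(X,d,\mu)$ is a metric measure space, $\mu$ is Borel regular, $0<\mu(B)<\infty$ for every ball $B$, and $X$ is proper (closed bounded sets are compact). $X$ is locally connected if every neighborhood of each point contains a connected neighborhood of it. $A\Subset\Omega$ means that the closure of $A$ is a compact subset of $\Omega$. A locally integrable $f:\Omega\to\mathbb{R}$ is strongly harmonic in $\Omega$ if $f(x)=\frac{1}{\mu(B(x,r))}\int_{B(x,r)}f\,d\mu$ for all $x\in\Omega$, $r>0$ with $B(x,r)\Subset\Omega$.
   Formalization: It is additionally assumed that Ω contains no connected component of X (for connected X: Ω ≠ X); without this the claim fails, e.g. for X = Ω = [0,1] and f = 1, where ∂Ω is empty. *)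

theory Defs
  imports "HOL-Analysis.Analysis"
begin

text \<open>
  The space \<open>X\<close> is the type \<open>'a\<close>. Borel regularity is usually stated for an outer measure on
  all subsets of \<open>X\<close>. Here \<open>\<mu>\<close> is a measure on some sigma-algebra containing the Borel sets
  (either the Borel sets themselves or a larger one, such as the Caratheodory-measurable sets), and
  regularity is stated for the outer measure it induces on arbitrary sets.
\<close>

definition borel_regular :: "'a::topological_space measure \<Rightarrow> bool" where
  "borel_regular \<mu> \<longleftrightarrow>
     space \<mu> = UNIV \<and> sets borel \<subseteq> sets \<mu> \<and>
     (\<forall>A. \<exists>B\<in>sets borel. A \<subseteq> B \<and> emeasure \<mu> B = outer_measure_of \<mu> A)"

locale proper_metric_measure_space =
  fixes \<mu> :: "'a::metric_space measure"
  assumes borel_regular: "borel_regular \<mu>"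
    and ball_measure: "r > 0 \<Longrightarrow> 0 < emeasure \<mu> (ball x r) \<and> emeasure \<mu> (ball x r) < \<infinity>"
    and proper: "closed (S :: 'a set) \<Longrightarrow> bounded S \<Longrightarrow> compact S"

definition compactly_contained :: "'a::topological_space set \<Rightarrow> 'a set \<Rightarrow> bool"
    (infix "\<Subset>" 50) where
  "A \<Subset> \<Omega> \<longleftrightarrow> compact (closure A) \<and> closure A \<subseteq> \<Omega>"

definition locally_integrable_on ::
    "'a::metric_space measure \<Rightarrow> 'a set \<Rightarrow> ('a \<Rightarrow> real) \<Rightarrow> bool" where
  "locally_integrable_on \<mu> \<Omega> f \<longleftrightarrow>
     (\<forall>x\<in>\<Omega>. \<exists>r>0. ball x r \<subseteq> \<Omega> \<and> set_integrable \<mu> (ball x r) f)"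

text \<open>
  A function on \<open>\<Omega>\<close> is a total function of which only the values on \<open>\<Omega>\<close> matter.
\<close>

definition strongly_harmonic_on ::
    "'a::metric_space measure \<Rightarrow> 'a set \<Rightarrow> ('a \<Rightarrow> real) \<Rightarrow> bool" where
  "strongly_harmonic_on \<mu> \<Omega> f \<longleftrightarrow>
     locally_integrable_on \<mu> \<Omega> f \<and>
     (\<forall>x\<in>\<Omega>. \<forall>r>0. ball x r \<Subset> \<Omega> \<longrightarrow>
        f x = (1 / measure \<mu> (ball x r)) * (LINT y:ball x r|\<mu>. f y))"

end

theory Submission imports Defs
begin

text \<open>
  At a point where \<open>f\<close> attains its maximum over the compact set \<open>closure \<Omega>\<close>, the mean value property
  makes \<open>f\<close> constant on a small ball, because balls have positive measure. If no frontier point is a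
  maximum point, the maximum set is then both closed and open in \<open>X\<close>, so it contains a component of
  \<open>X\<close>, and that component lies in \<open>\<Omega>\<close>.
\<close>

context proper_metric_measure_space
begin

lemma sets_open: "open S \<Longrightarrow> S \<in> sets \<mu>"
  using borel_regular unfolding borel_regular_def by auto

lemma borel_measurable_subset: "borel_measurable borel \<subseteq> borel_measurable \<mu>"
  using borel_regular unfolding borel_regular_def by (intro measurable_mono) auto

text \<open>Properness makes the closed ball compact, so \<open>f\<close> is bounded on it, and the
  ball has finite measure. Local integrability would only give some small ball about
  \<open>x\<close>, not one of prescribed radius.\<close>

lemma set_integrable_ball_continuous:
  fixes f :: "'a \<Rightarrow> real"
  assumes "r > 0" "continuous_on (cball x r) f"
  shows "set_integrable \<mu> (ball x r) f"
proof -
  have "compact (cball x r)"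
    by (intro proper) auto
  then have "bounded (f ` cball x r)"
    by (intro compact_imp_bounded compact_continuous_image assms)
  then obtain B where B: "\<And>y. y \<in> cball x r \<Longrightarrow> norm (f y) \<le> B"
    unfolding bounded_iff by blast
  then have B': "norm (f y) \<le> \<bar>B\<bar>" if "y \<in> ball x r" for y
    using that by (meson abs_ge_self ball_subset_cball order_trans subsetD)
  have "continuous_on (ball x r) f"
    using assms(2) by (rule continuous_on_subset) auto
  then have "(\<lambda>y. indicator (ball x r) y *\<^sub>R f y) \<in> borel_measurable borel"
    by (intro borel_measurable_continuous_on_indicator) auto
  then have meas: "(\<lambda>y. indicator (ball x r) y *\<^sub>R f y) \<in> borel_measurable \<mu>"
    using borel_measurable_subset by blast
  have "integrable \<mu> (\<lambda>y. indicat_real (ball x r) y *\<^sub>R B)"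
    using ball_measure[OF assms(1)] sets_open[of "ball x r"]
    by (intro integrable_scaleR_left integrable_real_indicator) auto
  then show ?thesis
    unfolding set_integrable_def
    by (rule Bochner_Integration.integrable_bound[OF _ meas])
      (use B' in \<open>auto simp: indicator_def simp del: mem_ball\<close>)
qed

text \<open>The nonnegative difference \<open>f x - f y\<close> has integral zero over the ball,
  hence vanishes almost everywhere; continuity and the positive measure of smaller balls turn this
  into every point.\<close>

lemma max_constant_on_ball:
  fixes f :: "'a \<Rightarrow> real"
  assumes r: "r > 0" and cont: "continuous_on (cball x r) f"
    and max: "\<And>y. y \<in> ball x r \<Longrightarrow> f y \<le> f x"
    and mean: "f x = (1 / measure \<mu> (ball x r)) * (LINT y:ball x r|\<mu>. f y)"
    and y: "y \<in> ball x r"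
  shows "f y = f x"
proof (rule ccontr)
  assume "f y \<noteq> f x"
  then have less: "f y < f x"
    using max[OF y] by simp
  have pos: "measure \<mu> (ball x r) > 0" and fin: "emeasure \<mu> (ball x r) < \<infinity>"
    using ball_measure[OF r, of x] by (auto simp: measure_def enn2real_positive_iff)
  have S: "ball x r \<in> sets \<mu>"
    by (simp add: sets_open)
  have int_f: "set_integrable \<mu> (ball x r) f"
    using r cont by (rule set_integrable_ball_continuous)
  have int_c: "set_integrable \<mu> (ball x r) (\<lambda>_. f x)"
    using fin S by (simp add: set_integrable_def)
  let ?g = "\<lambda>y. indicat_real (ball x r) y *\<^sub>R (f x - f y)"
  have int_g: "integrable \<mu> ?g"
    using set_integral_diff(1)[OF int_c int_f] by (simp add: set_integrable_def)
  have "(LINT y:ball x r|\<mu>. f x - f y) = measure \<mu> (ball x r) * f x - (LINT y:ball x r|\<mu>. f y)"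
    using set_integral_diff(2)[OF int_c int_f] S fin by (simp add: set_lebesgue_integral_def)
  also have "\<dots> = 0"
    using mean pos by (simp add: field_simps)
  finally have "integral\<^sup>L \<mu> ?g = 0"
    by (simp add: set_lebesgue_integral_def)
  moreover have "AE y in \<mu>. 0 \<le> ?g y"
    using max by (intro AE_I2) (auto simp: indicator_def)
  ultimately have AE: "AE y in \<mu>. ?g y = 0"
    using integral_nonneg_eq_0_iff_AE[OF int_g] by blast
  have "continuous_on (ball x r) f"
    using cont by (rule continuous_on_subset) auto
  then have "open (ball x r \<inter> f -` {..<f x})"
    by (intro continuous_open_preimage) auto
  moreover have "y \<in> ball x r \<inter> f -` {..<f x}"
    using y less by simp
  ultimately obtain e where e: "e > 0" "ball y e \<subseteq> ball x r \<inter> f -` {..<f x}"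
    unfolding open_contains_ball by blast
  \<comment> \<open>On \<open>ball y e\<close> the function \<open>?g\<close> is strictly positive,
    so its vanishing almost everywhere makes this ball null.\<close>
  from AE have "AE z in \<mu>. z \<notin> ball y e"
  proof eventually_elim
    case (elim z)
    with e(2) show ?case
      by (fastforce simp: indicator_def split: if_splits)
  qed
  then have "ball y e \<in> null_sets \<mu>"
    using AE_iff_null_sets[of "ball y e" \<mu>] sets_open[of "ball y e"] by simp
  then show False
    using ball_measure[OF e(1), of y] by auto
qed

lemma strongly_harmonic_max_set_open:
  fixes f :: "'a \<Rightarrow> real"
  assumes "open \<Omega>" and cont: "continuous_on \<Omega> f" and harm: "strongly_harmonic_on \<mu> \<Omega> f"
    and max: "\<And>y. y \<in> \<Omega> \<Longrightarrow> f y \<le> M"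
  shows "open {x\<in>\<Omega>. f x = M}"
  unfolding open_contains_ball
proof
  fix x assume "x \<in> {x\<in>\<Omega>. f x = M}"
  then have x: "x \<in> \<Omega>" "f x = M"
    by auto
  obtain r where r: "r > 0" "cball x r \<subseteq> \<Omega>"
    using assms(1) x(1) open_contains_cball by blast
  \<comment> \<open>The inclusion can be strict in a metric space, but it suffices for compact
    containment.\<close>
  have sub: "closure (ball x r) \<subseteq> cball x r"
    by (rule closure_minimal) auto
  have "compact (closure (ball x r))"
    by (intro proper) (auto simp: bounded_closure)
  with sub r(2) have "ball x r \<Subset> \<Omega>"
    by (auto simp: compactly_contained_def)
  then have "f x = (1 / measure \<mu> (ball x r)) * (LINT y:ball x r|\<mu>. f y)"
    using harm x(1) r(1) by (auto simp: strongly_harmonic_on_def)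
  moreover have "continuous_on (cball x r) f"
    using cont r(2) by (rule continuous_on_subset)
  moreover have "ball x r \<subseteq> \<Omega>"
    using r(2) ball_subset_cball by blast
  ultimately have "ball x r \<subseteq> {x\<in>\<Omega>. f x = M}"
    using max_constant_on_ball[OF r(1), of x f] max x(2) by blast
  with r(1) show "\<exists>e>0. ball x e \<subseteq> {x\<in>\<Omega>. f x = M}"
    by blast
qed

end

text \<open>A connected set that meets a clopen set cannot leave it, so the component of any point
  of \<open>K\<close> will do.\<close>

lemma component_subset_clopen:
  fixes K :: "'a::topological_space set"
  assumes "open K" "closed K" "K \<noteq> {}"
  shows "\<exists>C\<in>components UNIV. C \<subseteq> K"
proof -
  from assms(3) obtain x where x: "x \<in> K"
    by blast
  let ?C = "connected_component_set UNIV x"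
  have "?C \<inter> K = {} \<or> ?C \<inter> - K = {}"
    using connectedD[OF connected_connected_component assms(1), of "- K"] assms(2)
    by (auto simp: open_Compl Int_commute)
  moreover have "x \<in> ?C"
    by (simp add: connected_component_refl)
  ultimately have "?C \<subseteq> K"
    using x by blast
  then show ?thesis
    by (auto simp: components_def)
qed

text \<open>The hypothesis \<open>no_component_inside\<close> excludes cases such as
  \<open>\<Omega> = UNIV\<close> in a compact space: the frontier is then empty, and two different
  constants, both strongly harmonic, cannot both equal the supremum of the empty set. For connected
  \<open>X\<close> it says that \<open>\<Omega>\<close> is not the whole space.\<close>

theorem proposition4p3:
  fixes \<mu> :: "'a::metric_space measure" and \<Omega> :: "'a set" and f :: "'a \<Rightarrow> real"
  assumes "proper_metric_measure_space \<mu>"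
    and "locally connected (UNIV :: 'a set)"
    and "open \<Omega>" and "bounded \<Omega>"
    and no_component_inside: "\<forall>C\<in>components (UNIV :: 'a set). \<not> C \<subseteq> \<Omega>"
    and "continuous_on (closure \<Omega>) f"
    and "strongly_harmonic_on \<mu> \<Omega> f"
  shows "(SUP x\<in>closure \<Omega>. f x) = (SUP x\<in>frontier \<Omega>. f x)"
proof (cases "\<Omega> = {}")
  case False
  interpret proper_metric_measure_space \<mu>
    by fact
  have "compact (closure \<Omega>)"
    using assms(4) by (intro proper) auto
  then obtain x0 where x0: "x0 \<in> closure \<Omega>" "\<And>y. y \<in> closure \<Omega> \<Longrightarrow> f y \<le> f x0"
    using continuous_attains_sup[of "closure \<Omega>" f] assms(6) False by auto
  have "\<exists>z\<in>frontier \<Omega>. f z = f x0"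
  proof (rule ccontr)
    assume neg: "\<not> (\<exists>z\<in>frontier \<Omega>. f z = f x0)"
    have frontier: "frontier \<Omega> = closure \<Omega> - \<Omega>"
      using assms(3) by (simp add: frontier_def interior_open)
    let ?K = "{x\<in>\<Omega>. f x = f x0}"
    \<comment> \<open>By \<open>neg\<close>, no maximum point lies on the frontier, so replacing
      \<open>\<Omega>\<close> by its closure adds none; this is why \<open>?K\<close> is
      closed.\<close>
    have K: "?K = closure \<Omega> \<inter> f -` {f x0}"
      using neg frontier closure_subset[of \<Omega>] by auto
    have "closed ?K"
      unfolding K by (intro continuous_closed_preimage assms(6)) auto
    moreover have "open ?K"
      using closure_subset[of \<Omega>] assms(6) x0(2)
      by (intro strongly_harmonic_max_set_open assms) (auto intro: continuous_on_subset)
    moreover have "?K \<noteq> {}"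
      using x0(1) unfolding K by blast
    ultimately obtain C where "C \<in> components UNIV" "C \<subseteq> ?K"
      using component_subset_clopen by blast
    then show False
      using no_component_inside by blast
  qed
  then obtain z where z: "z \<in> frontier \<Omega>" "f z = f x0"
    by blast
  have sub: "frontier \<Omega> \<subseteq> closure \<Omega>"
    by (auto simp: frontier_def)
  \<comment> \<open>Both suprema are attained maxima, at \<open>x0\<close> and at \<open>z\<close>,
    so nonemptiness and boundedness come for free.\<close>
  have "(SUP x\<in>closure \<Omega>. f x) = f x0"
    using x0 by (intro cSup_eq_maximum) auto
  moreover have "(SUP x\<in>frontier \<Omega>. f x) = f x0"
    using z x0(2) sub by (intro cSup_eq_maximum) (auto intro: rev_image_eqI)
  ultimately show ?thesis
    by simp
\<comment> \<open>For empty \<open>\<Omega>\<close> both sides are the supremum of the empty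
  set.\<close>
qed simp

end
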